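(* Let $A$ be an $n\times m$ nonnegative real matrix without zero columns which contains a diagonal principal submatrix of the same rank $k$ as $A$. Then every factorization $A=FV$ of $A$ produced by the lattice-subspace factorization procedure (described in the context) is a nonnegative rank factorization of $A$. That is, for any basic set $\{y_1,\dots,y_r\}$ of the rows of $A$, with $d$ the number of vertices of the convex polytope $K$ generated by the range of the basic function of $y_1,\dots,y_r$, and for any minimal lattice-subspace $Z$ of $\mathbb{R}^m$ containing $y_1,\dots,y_r$, any positive basis $\{b_1,\dots,b_d\}$ of $Z$ and any set of nodes $\{i_1,\dots,i_d\}$ of this basis, the $n\times d$ matrix $F$ whose $j$-th column is the $i_j$-th column of $A$ multiplied by $\frac{1}{b_j(i_j)}$ and the $d\times m$ matrix $V$ with rows $b_1,\dots,b_d$ are nonnegative, satisfy $A=FV$, and have intermediate dimension $d=\operatorname{rank}(A)=k$.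
   Context: For $x\in\mathbb{R}^m$, $x(i)$ denotes the $i$-th coordinate of $x$. $\mathbb{R}^m$ is ordered coordinatewise; $\mathbb{R}^m_+=\{x: x(i)\ge 0\ \forall i\}$. A matrix is nonnegative if all its entries are $\ge 0$. A linear subspace $Y\subseteq\mathbb{R}^m$ is ordered by the induced ordering, with positive cone $Y_+=Y\cap\mathbb{R}^m_+$. "$A$ contains a diagonal principal submatrix of the same rank $k$" means: after permuting the rows of $A$ and (independently) permuting the columns of $A$, one obtains a matrix $\overline{A}$ which has a diagonal $k\times k$ submatrix $D_k$ with $\operatorname{rank}(A)=\operatorname{rank}(D_k)=k$. Lattice-subspace: a linear subspace $Y$ of $\mathbb{R}^m$ such that for all $x,y\in Y$ the set $\{x,y\}$ has a supremum and an infimum in the ordered space $Y$ (a least element of the set of upper bounds belonging to $Y$, and a greatest element of the set of lower bounds belonging to $Y$); these need not be the coordinatewise ones. Positive basis of $Y$: a linear basis $\{b_1,\dots,b_\nu\}$ of $Y$ such that $Y_+=\{\sum_{i=1}^\nu\lambda_i b_i : \lambda_i\ge 0 \text{ for each } i\}$. Set of nodes of a positive basis $\{b_1,\dots,b_\nu\}$: indices $\{i_1,\dots,i_\nu\}\subseteq\{1,\dots,m\}$ such that for every $k$ one has $b_k(i_k)>0$ and $b_j(i_k)=0$ for all $j\ne k$. Minimal lattice-subspace containing a set $S\subseteq\mathbb{R}^m_+$: a lattice-subspace $Y$ of $\mathbb{R}^m$ with $S\subseteq Y$ such that no proper linear subspace of $Y$ is a lattice-subspace of $\mathbb{R}^m$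 containing $S$. Basic set of the rows of $A$: a maximal set $\{y_1,\dots,y_r\}$ of linearly independent rows of $A$. Basic function of $y_1,\dots,y_r$: with $y=y_1+\dots+y_r$, the function $\beta:\{1,\dots,m\}\to\mathbb{R}^r_+$, $\beta(i)=\left(\frac{y_1(i)}{y(i)},\dots,\frac{y_r(i)}{y(i)}\right)$ (here $y(i)>0$ for all $i$ since $A$ has no zero columns). $K$ is the convex hull in $\mathbb{R}^r$ of the range $R(\beta)=\{\beta(i): i=1,\dots,m\}$, and its vertices are its extreme points. Lattice-subspace factorization procedure: choose a basic set $\{y_1,\dots,y_r\}$ of the rows of $A$; let $d$ be the number of vertices of $K$; take a positive basis $\{b_1,\dots,b_d\}$ of a minimal lattice-subspace $Z$ of $\mathbb{R}^m$ containing $y_1,\dots,y_r$ and a set of nodes $\{i_1,\dots,i_d\}$ of it; let $F$ be the $n\times d$ matrix whose $j$-th column is the $i_j$-th column of $A$ multiplied by $1/b_j(i_j)$ and $V$ the $d\times m$ matrix with rows $b_1,\dots,b_d$. Nonnegative rank factorization of $A$: a factorization $A=FV$ with $F$, $V$ nonnegative of sizes $n\times p$, $p\times m$, whose intermediate dimension $p$ equals $\operatorname{rank}(A)$. *)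

theory Defs
  imports "HOL-Analysis.Analysis"
begin

text \<open>An n by m matrix is an element of \<open>real^'m^'n\<close>, and \<open>real^'m\<close> carries the library's
  coordinatewise order. The numbers k, r and d are the cardinalities of index types
  \<open>'k\<close>, \<open>'r\<close> and \<open>'d\<close>; as these types are nonempty, the numbers are positive, which is no
  restriction for a matrix without zero columns.\<close>

definition nonneg_matrix :: "real^'m^'n \<Rightarrow> bool" where
  "nonneg_matrix A \<longleftrightarrow> (\<forall>i j. 0 \<le> A $ i $ j)"

definition permute_rows_cols :: "('n \<Rightarrow> 'n) \<Rightarrow> ('m \<Rightarrow> 'm) \<Rightarrow> real^'m^'n \<Rightarrow> real^'m^'n" where
  "permute_rows_cols p q A = (\<chi> i j. A $ p i $ q j)"

definition is_submatrix :: "real^'l^'k \<Rightarrow> real^'m^'n \<Rightarrow> bool" where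
  "is_submatrix D B \<longleftrightarrow>
     (\<exists>f g. inj f \<and> inj g \<and> D = (\<chi> a b. B $ f a $ g b))"

definition diagonal_matrix :: "real^'k^'k \<Rightarrow> bool" where
  "diagonal_matrix D \<longleftrightarrow> (\<forall>i j. i \<noteq> j \<longrightarrow> D $ i $ j = 0)"

text \<open>Rows and columns are permuted independently, so "principal" puts no link between the
  row and the column indices of the submatrix in A itself.\<close>

definition contains_diagonal_principal_submatrix :: "real^'m^'n \<Rightarrow> real^'k^'k \<Rightarrow> bool" where
  "contains_diagonal_principal_submatrix A D \<longleftrightarrow>
     diagonal_matrix D \<and>
     (\<exists>p q. p permutes UNIV \<and> q permutes UNIV \<and> is_submatrix D (permute_rows_cols p q A)) \<and>
     rank D = CARD('k) \<and> rank A = rank D"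

definition lattice_subspace :: "(real^'m) set \<Rightarrow> bool" where
  "lattice_subspace Y \<longleftrightarrow> subspace Y \<and>
     (\<forall>x\<in>Y. \<forall>y\<in>Y.
        (\<exists>s\<in>Y. x \<le> s \<and> y \<le> s \<and> (\<forall>u\<in>Y. x \<le> u \<and> y \<le> u \<longrightarrow> s \<le> u)) \<and>
        (\<exists>t\<in>Y. t \<le> x \<and> t \<le> y \<and> (\<forall>u\<in>Y. u \<le> x \<and> u \<le> y \<longrightarrow> u \<le> t)))"

definition minimal_lattice_subspace :: "(real^'m) set \<Rightarrow> (real^'m) set \<Rightarrow> bool" where
  "minimal_lattice_subspace S Y \<longleftrightarrow> lattice_subspace Y \<and> S \<subseteq> Y \<and>
     \<not> (\<exists>W. subspace W \<and> W \<subset> Y \<and> lattice_subspace W \<and> S \<subseteq> W)"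

definition positive_basis :: "('d::finite \<Rightarrow> real^'m) \<Rightarrow> (real^'m) set \<Rightarrow> bool" where
  "positive_basis b Y \<longleftrightarrow> inj b \<and> independent (range b) \<and> span (range b) = Y \<and>
     {x \<in> Y. 0 \<le> x} = {(\<Sum>i\<in>UNIV. l i *\<^sub>R b i) | l. \<forall>i. 0 \<le> l i}"

definition set_of_nodes :: "('d \<Rightarrow> real^'m) \<Rightarrow> ('d \<Rightarrow> 'm) \<Rightarrow> bool" where
  "set_of_nodes b \<iota> \<longleftrightarrow> (\<forall>k. 0 < b k $ \<iota> k \<and> (\<forall>j. j \<noteq> k \<longrightarrow> b j $ \<iota> k = 0))"

definition basic_set :: "real^'m^'n \<Rightarrow> ('r \<Rightarrow> real^'m) \<Rightarrow> bool" where
  "basic_set A y \<longleftrightarrow> inj y \<and> range y \<subseteq> rows A \<and> independent (range y) \<and>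
     (\<forall>T. range y \<subseteq> T \<and> T \<subseteq> rows A \<and> independent T \<longrightarrow> T = range y)"

definition basic_function :: "('r::finite \<Rightarrow> real^'m) \<Rightarrow> 'm \<Rightarrow> real^'r" where
  "basic_function y i = (\<chi> j. y j $ i / (\<Sum>l\<in>UNIV. y l) $ i)"

definition basic_polytope :: "('r::finite \<Rightarrow> real^'m) \<Rightarrow> (real^'r) set" where
  "basic_polytope y = convex hull (range (basic_function y))"

definition factor_F :: "real^'m^'n \<Rightarrow> ('d \<Rightarrow> real^'m) \<Rightarrow> ('d \<Rightarrow> 'm) \<Rightarrow> real^'d^'n" where
  "factor_F A b \<iota> = (\<chi> a j. (1 / b j $ \<iota> j) * A $ a $ \<iota> j)"

definition factor_V :: "('d \<Rightarrow> real^'m) \<Rightarrow> real^'m^'d" where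
  "factor_V b = (\<chi> j. b j)"

definition nonneg_rank_factorization :: "real^'m^'n \<Rightarrow> real^'p^'n \<Rightarrow> real^'m^'p \<Rightarrow> bool" where
  "nonneg_rank_factorization A F V \<longleftrightarrow>
     nonneg_matrix F \<and> nonneg_matrix V \<and> A = F ** V \<and> CARD('p) = rank A"

end

theory Submission
  imports Defs
begin

text \<open>The diagonal submatrix singles out \<open>k\<close> rows of \<open>A\<close> whose set of nodes consists of the
  chosen columns. A vector of their span has its coefficients read off at the nodes, so the order
  of the row space is the coordinatewise order of the coefficients and the row space is itself a
  lattice-subspace. Every basic set spans the row space, hence a minimal lattice-subspace
  containing a basic set is the row space, so \<open>d = k\<close>. Reading off at the nodes of \<open>b\<close> the
  coefficients of the rows of \<open>A\<close> gives \<open>A = F V\<close>.\<close>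

lemma set_of_nodes_sum_nth:
  fixes b :: "'d::finite \<Rightarrow> real^'m"
  assumes "set_of_nodes b \<iota>"
  shows "(\<Sum>j\<in>UNIV. l j *\<^sub>R b j) $ \<iota> k = l k * b k $ \<iota> k"
proof -
  have "(\<Sum>j\<in>UNIV. l j *\<^sub>R b j) $ \<iota> k = (\<Sum>j\<in>UNIV. if j = k then l k * b k $ \<iota> k else 0)"
    unfolding sum_component using assms by (intro sum.cong) (auto simp: set_of_nodes_def)
  then show ?thesis by simp
qed

text \<open>Coefficients are indexed by the type \<open>'d\<close>, not by the set
  \<open>range b\<close>, so that each one can be paired with the node of the same index.\<close>

lemma span_range_sum:
  fixes b :: "'d::finite \<Rightarrow> 'a::real_vector"
  assumes "x \<in> span (range b)"
  obtains l where "x = (\<Sum>j\<in>UNIV. l j *\<^sub>R b j)"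
  using assms
proof (induction arbitrary: thesis rule: span_induct_alt)
  case base
  show ?case by (rule base[of "\<lambda>_. 0"]) simp
next
  case (step c v w)
  obtain l where l: "w = (\<Sum>j\<in>UNIV. l j *\<^sub>R b j)" using step.IH by blast
  obtain i where i: "v = b i" using step.hyps by blast
  have "c *\<^sub>R v = (\<Sum>j\<in>UNIV. if j = i then c *\<^sub>R b i else 0)" by (simp add: i)
  also have "\<dots> = (\<Sum>j\<in>UNIV. (if j = i then c else 0) *\<^sub>R b j)" by (intro sum.cong) auto
  finally have "c *\<^sub>R v + w = (\<Sum>j\<in>UNIV. ((if j = i then c else 0) + l j) *\<^sub>R b j)"
    by (simp add: l scaleR_left_distrib sum.distrib)
  then show ?case by (rule step.prems)
qed

text \<open>Evaluation at the node of \<open>b j\<close> kills every other term of a combination, so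
  the coefficient of \<open>b j\<close> is a quotient of two coordinates.\<close>

lemma set_of_nodes_expansion:
  fixes b :: "'d::finite \<Rightarrow> real^'m"
  assumes "set_of_nodes b \<iota>" and "x \<in> span (range b)"
  shows "x = (\<Sum>j\<in>UNIV. (x $ \<iota> j / b j $ \<iota> j) *\<^sub>R b j)"
proof -
  obtain l where l: "x = (\<Sum>j\<in>UNIV. l j *\<^sub>R b j)" using assms(2) by (rule span_range_sum)
  have "x $ \<iota> j / b j $ \<iota> j = l j" for j
    using assms(1) set_of_nodes_sum_nth[OF assms(1), of l j]
    by (simp add: l set_of_nodes_def less_imp_neq[symmetric])
  then show ?thesis using l by simp
qed

lemma set_of_nodes_inj:
  assumes "set_of_nodes b \<iota>"
  shows "inj b"
proof (rule injI, rule ccontr)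
  fix i j assume "b i = b j" "i \<noteq> j"
  moreover have "0 < b i $ \<iota> i" using assms unfolding set_of_nodes_def by blast
  moreover have "b j $ \<iota> i = 0" using assms \<open>i \<noteq> j\<close> unfolding set_of_nodes_def by metis
  ultimately show False by simp
qed

lemma set_of_nodes_independent:
  fixes b :: "'d::finite \<Rightarrow> real^'m"
  assumes "set_of_nodes b \<iota>"
  shows "independent (range b)"
proof
  assume "dependent (range b)"
  then obtain k where k: "b k \<in> span (range b - {b k})" unfolding dependent_def by auto
  \<comment> \<open>This hyperplane contains all the other vectors of the family, hence their span,
    but not \<open>b k\<close>.\<close>
  have "subspace {v. v $ \<iota> k = 0}" by (simp add: subspace_def)
  moreover have "b j $ \<iota> k = 0" if "b j \<noteq> b k" for j
    using assms that unfolding set_of_nodes_def by metis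
  then have "range b - {b k} \<subseteq> {v. v $ \<iota> k = 0}" by auto
  ultimately have "b k $ \<iota> k = 0" using k span_minimal by blast
  then show False using assms by (simp add: set_of_nodes_def less_imp_neq[symmetric])
qed

text \<open>By the expansion at the nodes, both vectors are combinations of the nonnegative
  \<open>b j\<close>, and the coefficients are the node values divided by positive numbers. An
  inequality at the nodes therefore spreads to all coordinates.\<close>

lemma set_of_nodes_le_iff:
  fixes b :: "'d::finite \<Rightarrow> real^'m"
  assumes "set_of_nodes b \<iota>" and "\<forall>j. 0 \<le> b j"
    and "u \<in> span (range b)" and "v \<in> span (range b)"
  shows "u \<le> v \<longleftrightarrow> (\<forall>j. u $ \<iota> j \<le> v $ \<iota> j)"
proof
  assume le: "\<forall>j. u $ \<iota> j \<le> v $ \<iota> j"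
  have "(\<Sum>j\<in>UNIV. (u $ \<iota> j / b j $ \<iota> j) *\<^sub>R b j) \<le> (\<Sum>j\<in>UNIV. (v $ \<iota> j / b j $ \<iota> j) *\<^sub>R b j)"
    unfolding less_eq_vec_def sum_component
  proof (intro allI sum_mono)
    fix i j
    have "0 \<le> b j $ i" "0 < b j $ \<iota> j"
      using assms(1,2) by (auto simp: set_of_nodes_def less_eq_vec_def)
    then show "((u $ \<iota> j / b j $ \<iota> j) *\<^sub>R b j) $ i \<le> ((v $ \<iota> j / b j $ \<iota> j) *\<^sub>R b j) $ i"
      using le by (simp add: mult_right_mono divide_right_mono)
  qed
  then show "u \<le> v"
    using set_of_nodes_expansion[OF assms(1,3)] set_of_nodes_expansion[OF assms(1,4)] by simp
qed (simp add: less_eq_vec_def)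

text \<open>Evaluation at the nodes is an order isomorphism from the span onto the real functions on
  \<open>'d\<close>, so suprema and infima are pulled back from there.\<close>

lemma lattice_subspace_span_set_of_nodes:
  fixes b :: "'d::finite \<Rightarrow> real^'m"
  assumes "set_of_nodes b \<iota>" and "\<forall>j. 0 \<le> b j"
  shows "lattice_subspace (span (range b))"
  unfolding lattice_subspace_def
proof (intro conjI ballI)
  fix x y assume xy: "x \<in> span (range b)" "y \<in> span (range b)"
  \<comment> \<open>The inverse isomorphism: \<open>w l\<close> is the vector of the span with node
    values \<open>l\<close>.\<close>
  define w :: "('d \<Rightarrow> real) \<Rightarrow> real^'m" where
    "w l = (\<Sum>j\<in>UNIV. (l j / b j $ \<iota> j) *\<^sub>R b j)" for l
  have w: "w l \<in> span (range b)" for l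
    unfolding w_def by (intro span_sum span_scale span_base) auto
  have w_nth: "w l $ \<iota> j = l j" for l j
    using assms(1) set_of_nodes_sum_nth[OF assms(1), of "\<lambda>j. l j / b j $ \<iota> j" j]
    by (simp add: w_def set_of_nodes_def less_imp_neq[symmetric])
  note le = set_of_nodes_le_iff[OF assms]
  show "\<exists>s\<in>span (range b). x \<le> s \<and> y \<le> s \<and>
      (\<forall>u\<in>span (range b). x \<le> u \<and> y \<le> u \<longrightarrow> s \<le> u)"
    \<comment> \<open>The maximum is taken at the nodes only; elsewhere this supremum may exceed the
      coordinatewise one.\<close>
    by (rule bexI[of _ "w (\<lambda>j. max (x $ \<iota> j) (y $ \<iota> j))"]) (simp_all add: le w w_nth xy)
  show "\<exists>t\<in>span (range b). t \<le> x \<and> t \<le> y \<and>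
      (\<forall>u\<in>span (range b). u \<le> x \<and> u \<le> y \<longrightarrow> u \<le> t)"
    by (rule bexI[of _ "w (\<lambda>j. min (x $ \<iota> j) (y $ \<iota> j))"]) (simp_all add: le w w_nth xy)
qed simp

lemma positive_basis_nonneg:
  assumes "positive_basis b Z"
  shows "0 \<le> b j"
proof -
  have "b j = (\<Sum>i\<in>UNIV. if i = j then b j else 0)" by simp
  also have "\<dots> = (\<Sum>i\<in>UNIV. (if i = j then 1 else 0) *\<^sub>R b i)" by (intro sum.cong) auto
  finally have "b j \<in> {(\<Sum>i\<in>UNIV. l i *\<^sub>R b i) | l. \<forall>i. 0 \<le> l i}"
    by (intro CollectI exI[of _ "\<lambda>i. if i = j then 1 else 0"]) simp
  also have "\<dots> = {x \<in> Z. 0 \<le> x}" using assms by (simp add: positive_basis_def)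
  finally show ?thesis by simp
qed

text \<open>A row outside the span could be adjoined without losing independence, against
  maximality.\<close>

lemma basic_set_span:
  assumes "basic_set A y"
  shows "span (range y) = span (rows A)"
proof
  show "span (range y) \<subseteq> span (rows A)" using assms by (simp add: basic_set_def span_mono)
  have "v \<in> span (range y)" if "v \<in> rows A" for v
  proof (rule ccontr)
    assume v: "v \<notin> span (range y)"
    then have "independent (insert v (range y))"
      using assms by (simp add: basic_set_def independent_insertI)
    moreover have "insert v (range y) \<subseteq> rows A" using assms that by (simp add: basic_set_def)
    ultimately have "insert v (range y) = range y"
      using assms unfolding basic_set_def by (metis subset_insertI)
    then show False using v span_base by blast
  qed
  then show "span (rows A) \<subseteq> span (range y)" by (simp add: span_minimal subsetI)
qed

text \<open>A zero on the diagonal would make a whole column zero and put a unit vector into the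
  kernel.\<close>

lemma diagonal_matrix_full_rank:
  fixes D :: "real^'k^'k"
  assumes "diagonal_matrix D" and "rank D = CARD('k)"
  shows "D $ i $ i \<noteq> 0"
proof
  assume "D $ i $ i = 0"
  then have "D $ j $ i = 0" for j using assms(1) by (metis diagonal_matrix_def)
  then have "D *v axis i 1 = 0" by (simp add: vec_eq_iff matrix_vector_mult_basis column_def)
  moreover have "inj ((*v) D)" using assms(2) by (simp add: full_rank_injective)
  ultimately have "axis i 1 = (0 :: real^'k)" by (metis injD matrix_vector_mult_0_right)
  then show False by simp
qed

text \<open>Undoing the permutations, the rows of \<open>A\<close> that meet \<open>D\<close> vanish
  at each other's diagonal columns. At their own they are positive, since \<open>A\<close> is
  nonnegative and \<open>D\<close> has full rank.\<close>

lemma diagonal_submatrix_nodes: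
  fixes A :: "real^'m^'n" and D :: "real^'k^'k"
  assumes "nonneg_matrix A" and "contains_diagonal_principal_submatrix A D"
  obtains c :: "'k \<Rightarrow> real^'m" and \<iota> where "range c \<subseteq> rows A" and "set_of_nodes c \<iota>"
proof -
  obtain p q f g where D: "D = (\<chi> a b. permute_rows_cols p q A $ f a $ g b)"
    and diag: "diagonal_matrix D" "rank D = CARD('k)"
    using assms(2) by (auto simp: contains_diagonal_principal_submatrix_def is_submatrix_def)
  have D_nth: "A $ p (f a) $ q (g b) = D $ a $ b" for a b
    by (simp add: D permute_rows_cols_def)
  have "set_of_nodes (\<lambda>a. row (p (f a)) A) (\<lambda>b. q (g b))"
    unfolding set_of_nodes_def
  proof (intro allI conjI impI)
    fix k
    have "0 \<le> D $ k $ k" using assms(1) by (simp add: D_nth[symmetric] nonneg_matrix_def)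
    then show "0 < row (p (f k)) A $ q (g k)"
      using diagonal_matrix_full_rank[OF diag, of k] by (simp add: row_def D_nth)
  next
    fix k j :: 'k assume "j \<noteq> k"
    then show "row (p (f j)) A $ q (g k) = 0"
      using diag(1) by (simp add: row_def D_nth diagonal_matrix_def)
  qed
  moreover have "range (\<lambda>a. row (p (f a)) A) \<subseteq> rows A" by (auto simp: rows_def)
  ultimately show ?thesis using that by blast
qed

text \<open>Row \<open>a\<close> of \<open>factor_F A b \<iota>\<close> lists the coefficients of
  row \<open>a\<close> of \<open>A\<close> in its expansion at the nodes.\<close>

lemma factor_F_mult_factor_V:
  fixes A :: "real^'m^'n" and b :: "'d::finite \<Rightarrow> real^'m"
  assumes "set_of_nodes b \<iota>" and "rows A \<subseteq> span (range b)"
  shows "A = factor_F A b \<iota> ** factor_V b"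
proof -
  have "row a A = (\<Sum>j\<in>UNIV. (A $ a $ \<iota> j / b j $ \<iota> j) *\<^sub>R b j)" for a
    using set_of_nodes_expansion[OF assms(1), of "row a A"] assms(2) by (auto simp: rows_def row_def)
  then have "row a A $ i = (\<Sum>j\<in>UNIV. A $ a $ \<iota> j / b j $ \<iota> j * b j $ i)" for a i by simp
  moreover have "A $ a $ i = row a A $ i" for a i by (simp add: row_def)
  moreover have "(factor_F A b \<iota> ** factor_V b) $ a $ i =
      (\<Sum>j\<in>UNIV. A $ a $ \<iota> j / b j $ \<iota> j * b j $ i)" for a i
    by (simp add: matrix_matrix_mult_def factor_F_def factor_V_def)
  ultimately have "A $ a $ i = (factor_F A b \<iota> ** factor_V b) $ a $ i" for a i by metis
  then show ?thesis by (intro vec_eq_iff[THEN iffD2] allI)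
qed

theorem theorem2p6:
  fixes A :: "real^'m^'n"
    and D :: "real^'k^'k"
    and y :: "'r::finite \<Rightarrow> real^'m"
    and Z :: "(real^'m) set"
    and b :: "'d::finite \<Rightarrow> real^'m"
    and \<iota> :: "'d \<Rightarrow> 'm"
  assumes "nonneg_matrix A"
    and "\<forall>j. column j A \<noteq> 0"
    and "contains_diagonal_principal_submatrix A D"
    and "basic_set A y"
    and "CARD('d) = card {v. v extreme_point_of basic_polytope y}"
    and "minimal_lattice_subspace (range y) Z"
    and "positive_basis b Z"
    and "set_of_nodes b \<iota>"
  shows "nonneg_rank_factorization A (factor_F A b \<iota>) (factor_V b) \<and>
         CARD('d) = rank A \<and> rank A = CARD('k)"
proof -
  have rank: "rank A = CARD('k)"
    using assms(3) by (simp add: contains_diagonal_principal_submatrix_def)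
  obtain c :: "'k \<Rightarrow> real^'m" and \<kappa> where c: "range c \<subseteq> rows A" "set_of_nodes c \<kappa>"
    using diagonal_submatrix_nodes[OF assms(1,3)] .
  \<comment> \<open>Independent rows as numerous as the rank must span the row space.\<close>
  have "card (range c) = dim (rows A)"
    using rank set_of_nodes_inj[OF c(2)] by (simp add: card_image row_rank_def)
  then have "rows A \<subseteq> span (range c)"
    using c(1) card_eq_dim set_of_nodes_independent[OF c(2)] by (metis finite finite_imageI)
  then have span_c: "span (range c) = span (rows A)"
    using c(1) by (simp add: subset_antisym span_mono span_minimal)
  have "0 \<le> v" if "v \<in> rows A" for v
    using that assms(1) by (auto simp: rows_def row_def less_eq_vec_def nonneg_matrix_def)
  then have "0 \<le> c a" for a using c(1) by blast
  then have lattice: "lattice_subspace (span (range y))"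
    using lattice_subspace_span_set_of_nodes[OF c(2)] span_c basic_set_span[OF assms(4)] by simp
  have "span (range y) \<subseteq> Z"
    using assms(6) by (simp add: minimal_lattice_subspace_def lattice_subspace_def span_minimal)
  \<comment> \<open>The span is a lattice-subspace inside \<open>Z\<close> containing the basic set,
    so minimality of \<open>Z\<close> excludes proper inclusion.\<close>
  then have "span (range y) = Z"
    using assms(6) lattice unfolding minimal_lattice_subspace_def
    by (metis psubsetI span_superset subspace_span)
  then have Z: "span (range b) = span (rows A)"
    using assms(7) basic_set_span[OF assms(4)] by (simp add: positive_basis_def)
  \<comment> \<open>The number of vectors in \<open>b\<close> is found as the dimension of the row
    space, of which \<open>b\<close> is a basis.\<close>
  have "CARD('d) = dim (range b)"
    using assms(7) by (simp add: positive_basis_def card_image dim_eq_card_independent)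
  also have "\<dots> = rank A" using Z by (metis dim_span row_rank_def)
  finally have d: "CARD('d) = rank A" .
  have "nonneg_matrix (factor_F A b \<iota>)"
    using assms(1,8) by (simp add: nonneg_matrix_def factor_F_def set_of_nodes_def less_imp_le)
  moreover have "nonneg_matrix (factor_V b)"
    using positive_basis_nonneg[OF assms(7)]
    by (simp add: nonneg_matrix_def factor_V_def less_eq_vec_def)
  moreover have "A = factor_F A b \<iota> ** factor_V b"
    using assms(8) Z by (intro factor_F_mult_factor_V) (auto intro: span_base)
  ultimately show ?thesis using d rank by (simp add: nonneg_rank_factorization_def)
qed

end
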